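(* Let $n=2t$ with $t\ge1$ an integer, let $a_1,a_2\in\mathbb{C}$ and $b_1,b_2,c_1,c_2\in\mathbb{C}\setminus\{0\}$, and let $K_n$ be the $n\times n$ pentadiagonal $2$-Toeplitz matrix defined in the context. Then the eigenvalues of $K_n$ are $\alpha_1,\dots,\alpha_n$, where for $1\le k\le n$ $$\alpha_k=\begin{cases} a_1-2\sqrt{b_1c_1}\cos\left(\frac{(k+1)\pi}{n+2}\right), & k \text{ odd},\\ a_2-2\sqrt{b_2c_2}\cos\left(\frac{k\pi}{n+2}\right), & k\text{ even},\end{cases}$$ and corresponding eigenvectors are $$\left[B_0(\alpha_j),B_1(\alpha_j),B_2(\alpha_j),\ldots,B_{n-2}(\alpha_j),B_{n-1}(\alpha_j)\right]^T\quad\text{for } \alpha_j,\ j=1,3,5,\ldots,n-1,$$ and $$\left[A_0(\alpha_j),A_1(\alpha_j),A_2(\alpha_j),\ldots,A_{n-2}(\alpha_j),A_{n-1}(\alpha_j)\right]^T\quad\text{for } \alpha_j,\ j=2,4,6,\ldots,n.$$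
   Context: The matrix $K_n=(k_{ij})_{1\le i,j\le n}$ has the following entries. For $i$ odd: $k_{ii}=a_1$, $k_{i,i+2}=b_1$ (if $i+2\le n$), $k_{i,i-2}=c_1$ (if $i-2\ge 1$). For $i$ even: $k_{ii}=a_2$, $k_{i,i+2}=b_2$ (if $i+2\le n$), $k_{i,i-2}=c_2$ (if $i-2\ge 1$). All other entries are $0$. The polynomial sequences $(A_i)_{i\ge0}$ and $(B_i)_{i\ge 0}$ in $\mathbb{C}[x]$ are defined by $A_0=0$, $A_1=1$, respectively $B_0=1$, $B_1=0$, and both sequences ($C=A$ or $C=B$) satisfy $xC_0=a_1C_0+b_1C_2$, $\;xC_1=a_2C_1+b_2C_3$, and for $i\ge3$: $xC_{i-1}=c_1C_{i-3}+a_1C_{i-1}+b_1C_{i+1}$ if $i$ is odd, $xC_{i-1}=c_2C_{i-3}+a_2C_{i-1}+b_2C_{i+1}$ if $i$ is even. Square roots denote fixed choices of complex square roots. *)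

theory Defs
  imports Complex_Main "Jordan_Normal_Form.Char_Poly" "Jordan_Normal_Form.Spectral_Radius"
begin

hide_const (open) Module.smult

text \<open>Entries of the pentadiagonal 2-Toeplitz matrix, with row and column indices starting at 1.\<close>

definition penta_entry ::
  "complex \<Rightarrow> complex \<Rightarrow> complex \<Rightarrow> complex \<Rightarrow> complex \<Rightarrow> complex \<Rightarrow> nat \<Rightarrow> nat \<Rightarrow> complex" where
  "penta_entry a1 a2 b1 b2 c1 c2 i j =
     (if odd i then
        (if j = i then a1 else if j = i + 2 then b1 else if i = j + 2 then c1 else 0)
      else
        (if j = i then a2 else if j = i + 2 then b2 else if i = j + 2 then c2 else 0))"

text \<open>Rows and columns of \<^const>\<open>mat\<close> are counted from 0, hence the shifts.\<close>

definition penta_mat ::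
  "complex \<Rightarrow> complex \<Rightarrow> complex \<Rightarrow> complex \<Rightarrow> complex \<Rightarrow> complex \<Rightarrow> nat \<Rightarrow> complex mat" where
  "penta_mat a1 a2 b1 b2 c1 c2 n =
     mat n n (\<lambda>(i, j). penta_entry a1 a2 b1 b2 c1 c2 (i + 1) (j + 1))"

definition penta_rec ::
  "complex \<Rightarrow> complex \<Rightarrow> complex \<Rightarrow> complex \<Rightarrow> complex \<Rightarrow> complex \<Rightarrow> (nat \<Rightarrow> complex poly) \<Rightarrow> bool" where
  "penta_rec a1 a2 b1 b2 c1 c2 C \<longleftrightarrow>
     [:0, 1:] * C 0 = smult a1 (C 0) + smult b1 (C 2) \<and>
     [:0, 1:] * C 1 = smult a2 (C 1) + smult b2 (C 3) \<and>
     (\<forall>i\<ge>3.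
        (odd i \<longrightarrow> [:0, 1:] * C (i - 1) =
           smult c1 (C (i - 3)) + smult a1 (C (i - 1)) + smult b1 (C (i + 1))) \<and>
        (even i \<longrightarrow> [:0, 1:] * C (i - 1) =
           smult c2 (C (i - 3)) + smult a2 (C (i - 1)) + smult b2 (C (i + 1))))"

text \<open>The solution of the recurrence with given first two terms: the recurrence is solved for
  its last term.\<close>

fun penta_seq ::
  "complex \<Rightarrow> complex \<Rightarrow> complex \<Rightarrow> complex \<Rightarrow> complex \<Rightarrow> complex \<Rightarrow>
   complex poly \<Rightarrow> complex poly \<Rightarrow> nat \<Rightarrow> complex poly" where
  "penta_seq a1 a2 b1 b2 c1 c2 u v 0 = u"
| "penta_seq a1 a2 b1 b2 c1 c2 u v (Suc 0) = v"
| "penta_seq a1 a2 b1 b2 c1 c2 u v (Suc (Suc 0)) = smult (1 / b1) ([:- a1, 1:] * u)"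
| "penta_seq a1 a2 b1 b2 c1 c2 u v (Suc (Suc (Suc 0))) = smult (1 / b2) ([:- a2, 1:] * v)"
| "penta_seq a1 a2 b1 b2 c1 c2 u v (Suc (Suc (Suc (Suc m)))) =
     (if even m then
        smult (1 / b1) ([:- a1, 1:] * penta_seq a1 a2 b1 b2 c1 c2 u v (Suc (Suc m))
          - smult c1 (penta_seq a1 a2 b1 b2 c1 c2 u v m))
      else
        smult (1 / b2) ([:- a2, 1:] * penta_seq a1 a2 b1 b2 c1 c2 u v (Suc (Suc m))
          - smult c2 (penta_seq a1 a2 b1 b2 c1 c2 u v m)))"

lemma penta_solve:
  fixes P Q R :: "complex poly"
  assumes "b \<noteq> 0"
  shows "[:0, 1:] * P = Q + smult a P + smult b R \<longleftrightarrow> R = smult (1 / b) ([:- a, 1:] * P - Q)"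
proof -
  have "[:0, 1:] = [:- a, 1:] + [:a:]"
    by simp
  then have "[:0, 1:] * P = [:- a, 1:] * P + smult a P"
    by (metis add_0 distrib_right mult_pCons_left mult_zero_left pCons_0_0 add.right_neutral)
  then have "[:0, 1:] * P = Q + smult a P + smult b R \<longleftrightarrow> smult b R = [:- a, 1:] * P - Q"
    by (auto simp del: mult_pCons_left mult_pCons_right simp: eq_diff_eq ac_simps)
  also have "\<dots> \<longleftrightarrow> R = smult (1 / b) ([:- a, 1:] * P - Q)"
  proof
    assume "smult b R = [:- a, 1:] * P - Q"
    then show "R = smult (1 / b) ([:- a, 1:] * P - Q)"
      using assms by (metis smult_smult smult_1_left nonzero_divide_eq_eq)
  next
    assume "R = smult (1 / b) ([:- a, 1:] * P - Q)"
    then show "smult b R = [:- a, 1:] * P - Q"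
      using assms by (simp del: mult_pCons_left mult_pCons_right)
  qed
  finally show ?thesis .
qed

lemma penta_rec_iff:
  assumes "b1 \<noteq> 0" "b2 \<noteq> 0"
  shows "C 0 = u \<and> C 1 = v \<and> penta_rec a1 a2 b1 b2 c1 c2 C
         \<longleftrightarrow> C = penta_seq a1 a2 b1 b2 c1 c2 u v"
proof -
  let ?S = "penta_seq a1 a2 b1 b2 c1 c2 u v"
  have shift: "(\<forall>i\<ge>3. P i) \<longleftrightarrow> (\<forall>m. P (m + 3))" for P :: "nat \<Rightarrow> bool"
    by (metis le_add2 le_add_diff_inverse2)
  have rec: "penta_rec a1 a2 b1 b2 c1 c2 C \<longleftrightarrow>
     C 2 = smult (1 / b1) ([:- a1, 1:] * C 0) \<and>
     C 3 = smult (1 / b2) ([:- a2, 1:] * C 1) \<and>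
     (\<forall>m. C (m + 4) = (if even m
        then smult (1 / b1) ([:- a1, 1:] * C (m + 2) - smult c1 (C m))
        else smult (1 / b2) ([:- a2, 1:] * C (m + 2) - smult c2 (C m))))" for C
  proof -
    have idx: "m + 3 - 1 = m + 2" "m + 3 - 3 = m" "m + 3 + 1 = m + 4" for m :: nat
      by simp_all
    have par: "odd (m + 3) \<longleftrightarrow> even m" "even (m + 3) \<longleftrightarrow> odd m" for m :: nat
      by simp_all
    have "[:0, 1:] * C 0 = smult a1 (C 0) + smult b1 (C 2)
        \<longleftrightarrow> C 2 = smult (1 / b1) ([:- a1, 1:] * C 0)"
      "[:0, 1:] * C 1 = smult a2 (C 1) + smult b2 (C 3)
        \<longleftrightarrow> C 3 = smult (1 / b2) ([:- a2, 1:] * C 1)"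
      using penta_solve[OF assms(1), of "C 0" 0 a1 "C 2"]
        penta_solve[OF assms(2), of "C 1" 0 a2 "C 3"]
      by (simp_all only: add_0_left diff_0_right)
    then show ?thesis
      unfolding penta_rec_def shift idx par penta_solve[OF assms(1)] penta_solve[OF assms(2)]
      by (simp only: if_bool_eq_conj) (metis (full_types))
  qed
  have S: "?S 0 = u" "?S 1 = v" "penta_rec a1 a2 b1 b2 c1 c2 ?S"
    unfolding rec by (simp_all add: numeral_eq_Suc del: mult_pCons_left mult_pCons_right)
  have "C = ?S" if C: "C 0 = u" "C 1 = v" "penta_rec a1 a2 b1 b2 c1 c2 C"
  proof
    fix m
    show "C m = ?S m"
    proof (induction m rule: less_induct)
      case (less m)
      consider "m = 0" | "m = 1" | "m = 2" | "m = 3" | k where "m = k + 4"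
      proof (cases "m < 4")
        case True
        then have "m = 0 \<or> m = 1 \<or> m = 2 \<or> m = 3"
          by linarith
        with that show ?thesis
          by blast
      next
        case False
        with that(5)[of "m - 4"] show ?thesis
          by simp
      qed
      then show ?case
      proof cases
        case 5
        have "C (k + 2) = ?S (k + 2)" "C k = ?S k"
          using 5 by (auto intro!: less)
        then show ?thesis
          using C(3) S(3) unfolding rec 5 by simp
      qed (use C S rec in auto)
    qed
  qed
  then show ?thesis
    using S by blast
qed

text \<open>The parameters \<open>s1\<close> and \<open>s2\<close> stand for square roots of \<open>b1 * c1\<close> and \<open>b2 * c2\<close>.\<close>

definition penta_eig ::
  "complex \<Rightarrow> complex \<Rightarrow> complex \<Rightarrow> complex \<Rightarrow> nat \<Rightarrow> nat \<Rightarrow> complex" where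
  "penta_eig a1 a2 s1 s2 n k =
     (if odd k then a1 - 2 * s1 * of_real (cos (real (k + 1) * pi / real (n + 2)))
      else a2 - 2 * s2 * of_real (cos (real k * pi / real (n + 2))))"

end

theory Submission
  imports Defs
begin

text \<open>Listing the odd rows and columns of the matrix before the even ones is a simultaneous
  permutation that turns it into the direct sum of two tridiagonal Toeplitz matrices of size
  \<open>t\<close>. With \<open>s\<^sup>2 = b c\<close> and \<open>x = a - 2 s cos \<phi>\<close>, the three-term recurrence of such a block is
  solved by \<open>(- s / b)\<^sup>m sin ((m + 1) \<phi>)\<close>, which vanishes at \<open>m = t\<close> for
  \<open>\<phi> = j \<pi> / (t + 1)\<close>. The resulting \<open>t\<close> eigenvalues of a block are distinct, hence
  determine its characteristic polynomial, although the two blocks may share eigenvalues.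
  The even and odd parts of \<open>A\<close> and \<open>B\<close> satisfy the block recurrences, and one part of each
  sequence is zero, so that evaluating at an eigenvalue gives an eigenvector.\<close>

section \<open>Characteristic polynomials: permutation, direct sum, distinct eigenvalues\<close>

lemma char_poly_permute:
  assumes A: "A \<in> carrier_mat n n" and p: "p permutes {0..<n}"
  shows "char_poly (mat n n (\<lambda>(i, j). A $$ (p i, p j))) = char_poly A"
proof -
  define M where "M = char_poly_matrix A"
  \<comment> \<open>\<open>R\<close> permutes the rows of \<open>M\<close>; \<open>R'\<close> then
    permutes the rows of the transpose, that is, the columns. Each pass costs one factor
    \<open>signof p\<close>, and the two signs cancel.\<close>
  define R where "R = mat n n (\<lambda>(i, j). M $$ (p i, j))"
  define R' where "R' = mat n n (\<lambda>(i, j). transpose_mat R $$ (p i, j))"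
  have M: "M \<in> carrier_mat n n" using A by (simp add: M_def)
  have R: "R \<in> carrier_mat n n" "R' \<in> carrier_mat n n" by (simp_all add: R_def R'_def)
  have lt: "p i < n" if "i < n" for i
    using permutes_in_image[OF p, of i] that by simp
  have inj: "p i = p j \<longleftrightarrow> i = j" for i j
    using permutes_inj[OF p] by (auto dest: injD)
  have "char_poly_matrix (mat n n (\<lambda>(i, j). A $$ (p i, p j))) = transpose_mat R'"
    using A by (intro eq_matI)
      (auto simp: R'_def R_def M_def char_poly_matrix_def lt inj)
  then have "char_poly (mat n n (\<lambda>(i, j). A $$ (p i, p j))) = det R'"
    using det_transpose[OF R(2)] by (simp add: char_poly_def)
  also have "\<dots> = signof p * det R"
    using det_permute_rows[OF _ p, of "transpose_mat R"] det_transpose[OF R(1)] R(1)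
    by (simp add: R'_def)
  also have "det R = signof p * det M"
    unfolding R_def by (rule det_permute_rows[OF M p])
  also have "signof p * (signof p * det M) = det M"
    by (cases p rule: sign_cases) simp_all
  finally show ?thesis by (simp add: M_def char_poly_def)
qed

lemma char_poly_block_diagonal:
  fixes A B :: "'a :: idom mat"
  assumes A: "A \<in> carrier_mat n n" and B: "B \<in> carrier_mat m m"
  shows "char_poly (four_block_mat A (0\<^sub>m n m) (0\<^sub>m m n) B) = char_poly A * char_poly B"
proof -
  have "char_poly_matrix (four_block_mat A (0\<^sub>m n m) (0\<^sub>m m n) B) =
      four_block_mat (char_poly_matrix A) (0\<^sub>m n m) (0\<^sub>m m n) (char_poly_matrix B)"
    using A B by (intro eq_matI) (auto simp: char_poly_matrix_def)
  then show ?thesis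
    using det_four_block_mat_lower_left_zero[of "char_poly_matrix A" n "0\<^sub>m n m" m "0\<^sub>m m n"
        "char_poly_matrix B"] A B
    by (simp add: char_poly_def)
qed

text \<open>Both sides are monic of degree \<open>card S\<close>, so their difference has smaller
  degree; it vanishes at the \<open>card S\<close> points of \<open>S\<close> and is therefore
  zero.\<close>

lemma char_poly_distinct_eigenvalues:
  fixes A :: "'a :: field mat"
  assumes A: "A \<in> carrier_mat (card S) (card S)" and fin: "finite S"
    and eig: "\<And>x. x \<in> S \<Longrightarrow> eigenvalue A x"
  shows "char_poly A = (\<Prod>x\<in>S. [:- x, 1:])"
proof (rule poly_eqI_degree_lead_coeff[where n = "card S" and A = S])
  have deg: "degree (\<Prod>x\<in>S. [:- x, 1:]) = card S"
    by (subst degree_prod_eq_sum_degree) auto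
  have "lead_coeff (\<Prod>x\<in>S. [:- x, 1:]) = 1"
    by (simp add: lead_coeff_prod)
  then show "coeff (char_poly A) (card S) = coeff (\<Prod>x\<in>S. [:- x, 1:]) (card S)"
    using degree_monic_char_poly[OF A] deg by simp
  show "degree (\<Prod>x\<in>S. [:- x, 1:]) \<le> card S" using deg by simp
  show "poly (char_poly A) x = poly (\<Prod>x\<in>S. [:- x, 1:]) x" if "x \<in> S" for x
    using eig[OF that] fin that by (auto simp: eigenvalue_root_char_poly[OF A] poly_prod)
qed (use degree_monic_char_poly[OF A] in auto)

section \<open>Band matrices and three-term recurrences\<close>

definition band_entry :: "nat \<Rightarrow> 'a \<Rightarrow> 'a \<Rightarrow> 'a \<Rightarrow> nat \<Rightarrow> nat \<Rightarrow> 'a :: zero" where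
  "band_entry d a b c i j = (if j = i then a else if j = i + d then b else if i = j + d then c else 0)"

lemma band_entry_Suc [simp]: "band_entry d a b c (Suc i) (Suc j) = band_entry d a b c i j"
  by (simp add: band_entry_def)

text \<open>Within the even indices a band at distance 2 becomes one at distance 1. The odd indices
  reduce to these by \<open>band_entry_Suc\<close>.\<close>

lemma band_entry_double: "band_entry 2 a b c (2 * i) (2 * j) = band_entry 1 a b c i j"
proof -
  have "2 * j = 2 * i \<longleftrightarrow> j = i" "2 * j = 2 * i + 2 \<longleftrightarrow> j = i + 1" "2 * i = 2 * j + 2 \<longleftrightarrow> i = j + 1"
    by linarith+
  then show ?thesis
    unfolding band_entry_def by simp
qed

text \<open>The condition on \<open>w\<close> covers rows whose right band entry falls outside the
  matrix: the missing term is zero, so these rows read like all others.\<close>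

lemma sum_band_entry:
  fixes w :: "nat \<Rightarrow> 'a :: comm_semiring_1"
  assumes i: "i < n" and d: "d > 0" and w: "n \<le> i + d \<Longrightarrow> w (i + d) = 0"
  shows "(\<Sum>j<n. band_entry d a b c i j * w j) =
    (if d \<le> i then c * w (i - d) else 0) + a * w i + b * w (i + d)"
proof -
  \<comment> \<open>For \<open>i < d\<close> the truncated difference \<open>i - d\<close> is 0, a
    genuine column; the guard \<open>d \<le> i\<close> removes that spurious term.\<close>
  have "band_entry d a b c i j * w j =
      (if j = i - d then if d \<le> i then c * w j else 0 else 0) +
      (if j = i then a * w j else 0) + (if j = i + d then b * w j else 0)" for j
    using d by (auto simp: band_entry_def)
  then have "(\<Sum>j<n. band_entry d a b c i j * w j) =
      (if i - d < n then if d \<le> i then c * w (i - d) else 0 else 0) +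
      (if i < n then a * w i else 0) + (if i + d < n then b * w (i + d) else 0)"
    by (simp add: sum.distrib)
  then show ?thesis
    using i w by (auto simp: not_less)
qed

text \<open>The sequence is infinite: the eigenvector equation of size t is this recurrence together
  with \<open>u t = 0\<close>.\<close>

definition tri_rec :: "'a \<Rightarrow> 'a \<Rightarrow> 'a \<Rightarrow> 'a \<Rightarrow> (nat \<Rightarrow> 'a :: comm_ring_1) \<Rightarrow> bool" where
  "tri_rec a b c x u \<longleftrightarrow> x * u 0 = a * u 0 + b * u 1 \<and>
     (\<forall>m. x * u (Suc m) = c * u m + a * u (Suc m) + b * u (m + 2))"

text \<open>The guarded form matches the right-hand side of \<open>sum_band_entry\<close>, so the
  eigenvector equation can be checked row by row.\<close>

lemma tri_rec_iff:
  "tri_rec a b c x u \<longleftrightarrow>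
     (\<forall>m. x * u m = (if 1 \<le> m then c * u (m - 1) else 0) + a * u m + b * u (m + 1))"
  (is "_ \<longleftrightarrow> (\<forall>m. ?P m)")
proof -
  have "(\<forall>m. ?P m) \<longleftrightarrow> ?P 0 \<and> (\<forall>m. ?P (Suc m))"
    by (metis not0_implies_Suc)
  then show ?thesis
    by (simp add: tri_rec_def numeral_eq_Suc)
qed

text \<open>As \<open>b\<close> is nonzero, each term is determined by its predecessors, so
  solutions are proportional. The factors on both sides express this without division.\<close>

lemma tri_rec_unique:
  fixes u w :: "nat \<Rightarrow> 'a :: idom"
  assumes u: "tri_rec a b c x u" and w: "tri_rec a b c x w" and b: "b \<noteq> 0"
    and init: "k * u 0 = l * w 0"
  shows "k * u m = l * w m"
proof -
  have 1: "k * u (Suc m) = l * w (Suc m)"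
    if "k * (if 1 \<le> m then c * u (m - 1) else 0) = l * (if 1 \<le> m then c * w (m - 1) else 0)"
      and "k * u m = l * w m" for m
  proof -
    have "k * (x * u m) = l * (x * w m)"
      using that(2) by (metis mult.left_commute)
    moreover have "k * (a * u m) = l * (a * w m)"
      using that(2) by (metis mult.left_commute)
    ultimately have "k * (b * u (m + 1)) = l * (b * w (m + 1))"
      using that(1) u[unfolded tri_rec_iff, rule_format, of m] w[unfolded tri_rec_iff, rule_format, of m]
      by (simp only: distrib_left) simp
    then have "b * (k * u (Suc m)) = b * (l * w (Suc m))"
      by (simp add: ac_simps)
    with b show ?thesis by simp
  qed
  \<comment> \<open>The recurrence has order two, so the induction carries two consecutive
    terms.\<close>
  have "k * u m = l * w m \<and> k * u (Suc m) = l * w (Suc m)"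
  proof (induction m)
    case 0
    show ?case using 1[of 0] init by simp
  next
    case (Suc m)
    then have "k * (c * u m) = l * (c * w m)"
      by (metis mult.left_commute)
    with Suc show ?case using 1[of "Suc m"] by simp
  qed
  then show ?thesis ..
qed

text \<open>With q = -s/b, dividing out q^m leaves v(m+2) = 2 cos \<phi> v(m+1) - v(m), which
  sin((m+1) \<phi>) satisfies by the addition formulas.\<close>

lemma tri_rec_sin:
  fixes a b c s :: complex and \<phi> :: real
  assumes b: "b \<noteq> 0" and s: "s ^ 2 = b * c"
  shows "tri_rec a b c (a - 2 * s * of_real (cos \<phi>))
    (\<lambda>m. (- s / b) ^ m * of_real (sin (real (m + 1) * \<phi>)))"
proof -
  define q where "q = - s / b"
  have sq: "s = - b * q" and c: "c = b * q ^ 2"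
    using b s by (simp_all add: q_def field_simps power2_eq_square)
  have trig: "sin (real (m + 3) * \<phi>) = 2 * cos \<phi> * sin (real (m + 2) * \<phi>) - sin (real (m + 1) * \<phi>)" for m
  proof -
    have "real (m + 3) * \<phi> = real (m + 2) * \<phi> + \<phi>" "real (m + 1) * \<phi> = real (m + 2) * \<phi> - \<phi>"
      by (simp_all add: algebra_simps)
    then show ?thesis by (simp only: sin_add sin_diff) simp
  qed
  have "(a - 2 * s * of_real (cos \<phi>)) * (q ^ Suc m * of_real (sin (real (m + 2) * \<phi>))) =
      c * (q ^ m * of_real (sin (real (m + 1) * \<phi>))) + a * (q ^ Suc m * of_real (sin (real (m + 2) * \<phi>)))
      + b * (q ^ (m + 2) * of_real (sin (real (m + 3) * \<phi>)))" for m
    unfolding trig c by (simp add: sq algebra_simps power2_eq_square)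
  \<comment> \<open>The first row has no predecessor term, in accordance with sin 0 = 0; it is the
    double-angle formula.\<close>
  moreover have "(a - 2 * s * of_real (cos \<phi>)) * of_real (sin \<phi>) =
      a * of_real (sin \<phi>) + b * (q * of_real (sin (2 * \<phi>)))"
    unfolding sin_double by (simp add: sq algebra_simps)
  ultimately show ?thesis
    unfolding tri_rec_def q_def[symmetric] by (simp add: numeral_eq_Suc)
qed

lemma sin_grid:
  assumes "1 \<le> j" "j \<le> t"
  shows "sin (real j * pi / real (t + 1)) \<noteq> 0"
    and "sin (real (t + 1) * (real j * pi / real (t + 1))) = 0"
proof -
  have "real j * pi < real (t + 1) * pi"
    using assms by (intro mult_strict_right_mono) auto
  then have "0 < real j * pi / real (t + 1)" "real j * pi / real (t + 1) < pi"
    using assms by (simp_all add: divide_less_eq mult.commute)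
  then show "sin (real j * pi / real (t + 1)) \<noteq> 0"
    using sin_gt_zero by force
  have "real (t + 1) * (real j * pi / real (t + 1)) = real j * pi"
    by simp
  then show "sin (real (t + 1) * (real j * pi / real (t + 1))) = 0"
    by (simp only: sin_npi)
qed

section \<open>The spectrum of a tridiagonal Toeplitz block\<close>

definition tri_eig :: "complex \<Rightarrow> complex \<Rightarrow> nat \<Rightarrow> nat \<Rightarrow> complex" where
  "tri_eig a s t j = a - 2 * s * of_real (cos (real j * pi / real (t + 1)))"

text \<open>Every solution is proportional to the sine solution, whose initial value sin \<phi> is
  nonzero and whose value at t is zero.\<close>

lemma tri_rec_tri_eig_zero:
  assumes "b \<noteq> 0" "s ^ 2 = b * c" "1 \<le> j" "j \<le> t" and u: "tri_rec a b c (tri_eig a s t j) u"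
  shows "u t = 0"
proof -
  let ?\<phi> = "real j * pi / real (t + 1)"
  let ?w = "\<lambda>m. (- s / b) ^ m * of_real (sin (real (m + 1) * ?\<phi>))"
  have "tri_rec a b c (tri_eig a s t j) ?w"
    unfolding tri_eig_def by (rule tri_rec_sin[OF assms(1,2)])
  then have "of_real (sin ?\<phi>) * u t = u 0 * ?w t"
    by (rule tri_rec_unique[OF u _ assms(1)]) simp
  with sin_grid[OF assms(3,4)] show ?thesis by simp
qed

definition tri_mat :: "'a \<Rightarrow> 'a \<Rightarrow> 'a \<Rightarrow> nat \<Rightarrow> 'a :: zero mat" where
  "tri_mat a b c t = mat t t (\<lambda>(i, j). band_entry 1 a b c i j)"

lemma eigenvalue_tri_mat:
  assumes "b \<noteq> 0" "s ^ 2 = b * c" "1 \<le> j" "j \<le> t"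
  shows "eigenvalue (tri_mat a b c t) (tri_eig a s t j)"
proof -
  let ?\<phi> = "real j * pi / real (t + 1)"
  let ?w = "\<lambda>m. (- s / b) ^ m * complex_of_real (sin (real (m + 1) * ?\<phi>))"
  have rec: "tri_rec a b c (tri_eig a s t j) ?w"
    unfolding tri_eig_def by (rule tri_rec_sin[OF assms(1,2)])
  have wt: "?w t = 0"
    by (rule tri_rec_tri_eig_zero[OF assms rec])
  have "tri_mat a b c t *\<^sub>v vec t ?w = tri_eig a s t j \<cdot>\<^sub>v vec t ?w"
  proof (rule eq_vecI)
    fix i assume "i < dim_vec (tri_eig a s t j \<cdot>\<^sub>v vec t ?w)"
    then have i: "i < t" by simp
    have "(tri_mat a b c t *\<^sub>v vec t ?w) $ i = (\<Sum>k<t. band_entry 1 a b c i k * ?w k)"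
      using i by (simp add: tri_mat_def scalar_prod_def lessThan_atLeast0)
    also have "\<dots> = tri_eig a s t j * ?w i"
    proof (subst sum_band_entry)
      \<comment> \<open>Only the last row reaches past the block, and there the sine solution
        vanishes.\<close>
      assume "t \<le> i + 1"
      with i have "i + 1 = t" by simp
      with wt show "?w (i + 1) = 0" by metis
    qed (use i rec[unfolded tri_rec_iff, rule_format, of i] in simp_all)
    finally show "(tri_mat a b c t *\<^sub>v vec t ?w) $ i = (tri_eig a s t j \<cdot>\<^sub>v vec t ?w) $ i"
      using i by simp
  qed (simp add: tri_mat_def)
  moreover have "vec t ?w $ 0 \<noteq> 0\<^sub>v t $ 0"
    using sin_grid(1)[OF assms(3,4)] assms(3,4) by simp
  then have "vec t ?w \<noteq> 0\<^sub>v t"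
    by (rule contrapos_nn) (rule arg_cong)
  ultimately show ?thesis
    unfolding eigenvalue_def eigenvector_def by (intro exI[of _ "vec t ?w"]) (simp add: tri_mat_def)
qed

text \<open>All the angles lie between 0 and pi, where cosine is injective.\<close>

lemma inj_on_tri_eig:
  assumes "s \<noteq> 0"
  shows "inj_on (tri_eig a s t) {1..t}"
proof (rule inj_onI)
  fix i j assume ij: "i \<in> {1..t}" "j \<in> {1..t}" and "tri_eig a s t i = tri_eig a s t j"
  then have "cos (real i * pi / real (t + 1)) = cos (real j * pi / real (t + 1))"
    using assms by (simp add: tri_eig_def)
  moreover have "0 \<le> real k * pi / real (t + 1) \<and> real k * pi / real (t + 1) \<le> pi"
    if "k \<in> {1..t}" for k
    using that mult_right_mono[of "real k" "real (t + 1)" pi]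
    by (simp add: divide_le_eq mult.commute)
  ultimately have "real i * pi / real (t + 1) = real j * pi / real (t + 1)"
    using ij cos_inj_pi by blast
  then show "i = j" by simp
qed

lemma char_poly_tri_mat:
  assumes b: "b \<noteq> 0" and c: "c \<noteq> 0" and s: "s ^ 2 = b * c"
  shows "char_poly (tri_mat a b c t) = (\<Prod>j = 1..t. [:- tri_eig a s t j, 1:])"
proof -
  \<comment> \<open>A nonzero product \<open>b * c\<close> makes the t eigenvalues distinct, so that
    they account for the full degree.\<close>
  have "s \<noteq> 0" using assms by auto
  then have inj: "inj_on (tri_eig a s t) {1..t}" by (rule inj_on_tri_eig)
  have "char_poly (tri_mat a b c t) = (\<Prod>x\<in>tri_eig a s t ` {1..t}. [:- x, 1:])"
  proof (rule char_poly_distinct_eigenvalues)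
    show "tri_mat a b c t \<in> carrier_mat (card (tri_eig a s t ` {1..t})) (card (tri_eig a s t ` {1..t}))"
      unfolding card_image[OF inj] by (simp add: tri_mat_def)
  qed (use eigenvalue_tri_mat[OF b s] in auto)
  then show ?thesis by (simp only: prod.reindex[OF inj] o_def)
qed

section \<open>Splitting the pentadiagonal matrix by parity\<close>

lemma penta_mat_index:
  assumes "i < n" "j < n"
  shows "penta_mat a1 a2 b1 b2 c1 c2 n $$ (i, j) =
    (if even i then band_entry 2 a1 b1 c1 i j else band_entry 2 a2 b2 c2 i j)"
  using assms by (auto simp: penta_mat_def penta_entry_def band_entry_def)

text \<open>With indices from 0, the even ones come first; they are the odd rows of the 1-based
  description. The last branch is the identity because \<open>permutes\<close> requires fixed points
  outside the range.\<close>

definition unshuffle :: "nat \<Rightarrow> nat \<Rightarrow> nat" where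
  "unshuffle t i = (if i < t then 2 * i else if i < 2 * t then 2 * (i - t) + 1 else i)"

lemma unshuffle_permutes: "unshuffle t permutes {0..<2 * t}"
proof (rule bij_imp_permutes)
  have inj: "inj_on (unshuffle t) {0..<2 * t}"
    by (rule inj_onI) (auto simp: unshuffle_def split: if_splits; presburger)
  have "unshuffle t ` {0..<2 * t} \<subseteq> {0..<2 * t}"
    by (auto simp: unshuffle_def)
  then show "bij_betw (unshuffle t) {0..<2 * t} {0..<2 * t}"
    using inj by (simp add: bij_betw_def endo_inj_surj)
qed (simp add: unshuffle_def)

lemma char_poly_penta_mat:
  "char_poly (penta_mat a1 a2 b1 b2 c1 c2 (2 * t)) =
    char_poly (tri_mat a1 b1 c1 t) * char_poly (tri_mat a2 b2 c2 t)"
proof -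
  let ?K = "penta_mat a1 a2 b1 b2 c1 c2 (2 * t)" and ?p = "unshuffle t"
  have lt: "?p i < 2 * t" if "i < 2 * t" for i
    using that by (auto simp: unshuffle_def)
  \<comment> \<open>Indices of opposite parity differ by an odd number, whereas band positions
    differ by 0 or 2; hence the off-diagonal blocks are zero.\<close>
  have mixed: "band_entry 2 a b c (2 * i) (Suc (2 * j)) = 0" "band_entry 2 a b c (Suc (2 * i)) (2 * j) = 0"
    for a b c :: complex and i j
  proof -
    have "Suc (2 * j) \<noteq> 2 * i" "Suc (2 * j) \<noteq> 2 * i + 2" "2 * i \<noteq> Suc (2 * j) + 2"
      "2 * j \<noteq> Suc (2 * i)" "2 * j \<noteq> Suc (2 * i) + 2" "Suc (2 * i) \<noteq> 2 * j + 2"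
      by presburger+
    then show "band_entry 2 a b c (2 * i) (Suc (2 * j)) = 0" "band_entry 2 a b c (Suc (2 * i)) (2 * j) = 0"
      unfolding band_entry_def by (simp_all only: if_False)
  qed
  have "mat (2 * t) (2 * t) (\<lambda>(i, j). ?K $$ (?p i, ?p j)) =
      four_block_mat (tri_mat a1 b1 c1 t) (0\<^sub>m t t) (0\<^sub>m t t) (tri_mat a2 b2 c2 t)"
    by (intro eq_matI)
      (auto simp: tri_mat_def penta_mat_index lt,
       auto simp: unshuffle_def band_entry_double mixed)
  moreover have "char_poly (mat (2 * t) (2 * t) (\<lambda>(i, j). ?K $$ (?p i, ?p j))) = char_poly ?K"
    by (rule char_poly_permute[OF _ unshuffle_permutes]) (simp add: penta_mat_def)
  ultimately show ?thesis
    by (simp add: char_poly_block_diagonal tri_mat_def)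
qed

text \<open>Row \<open>i\<close> involves only entries of the parity of \<open>i\<close>, so it is
  one instance of the recurrence for that parity.\<close>

lemma penta_mat_mult_vec:
  assumes u: "tri_rec a1 b1 c1 x (\<lambda>m. w (2 * m))" and v: "tri_rec a2 b2 c2 x (\<lambda>m. w (2 * m + 1))"
    and ut: "w (2 * t) = 0" and vt: "w (2 * t + 1) = 0"
  shows "penta_mat a1 a2 b1 b2 c1 c2 (2 * t) *\<^sub>v vec (2 * t) w = x \<cdot>\<^sub>v vec (2 * t) w"
proof (rule eq_vecI)
  let ?K = "penta_mat a1 a2 b1 b2 c1 c2 (2 * t)"
  fix i assume "i < dim_vec (x \<cdot>\<^sub>v vec (2 * t) w)"
  then have i: "i < 2 * t" by simp
  have end0: "w (i + 2) = 0" if "2 * t \<le> i + 2"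
  proof -
    \<comment> \<open>The last two rows reach just past the end, one for each parity.\<close>
    have "i + 2 = 2 * t \<or> i + 2 = 2 * t + 1" using that i by linarith
    with ut vt show ?thesis by metis
  qed
  have "(?K *\<^sub>v vec (2 * t) w) $ i = (\<Sum>k<2 * t. ?K $$ (i, k) * w k)"
    using i by (simp add: penta_mat_def scalar_prod_def lessThan_atLeast0)
  also have "\<dots> = (\<Sum>k<2 * t. (if even i then band_entry 2 a1 b1 c1 i k else band_entry 2 a2 b2 c2 i k) * w k)"
    by (rule sum.cong) (simp_all add: penta_mat_index i)
  also have "\<dots> = x * w i"
  proof (cases "even i")
    case True
    then obtain m where m: "i = 2 * m" by blast
    have "2 \<le> i \<longleftrightarrow> 1 \<le> m" "i - 2 = 2 * (m - 1)" "i + 2 = 2 * (m + 1)" using m by auto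
    then show ?thesis
      using True sum_band_entry[of i "2 * t" 2 w a1 b1 c1] i end0
        u[unfolded tri_rec_iff, rule_format, of m] m by simp
  next
    case False
    then obtain m where m: "i = 2 * m + 1" by (blast elim: oddE)
    have "2 \<le> i \<longleftrightarrow> 1 \<le> m" "i + 2 = 2 * (m + 1) + 1" "1 \<le> m \<Longrightarrow> i - 2 = 2 * (m - 1) + 1"
      using m by auto
    then show ?thesis
      using False sum_band_entry[of i "2 * t" 2 w a2 b2 c2] i end0
        v[unfolded tri_rec_iff, rule_format, of m] m by (auto split: if_splits)
  qed
  finally show "(?K *\<^sub>v vec (2 * t) w) $ i = (x \<cdot>\<^sub>v vec (2 * t) w) $ i"
    using i by simp
qed (simp add: penta_mat_def)

lemma tri_rec_poly_penta_rec:
  assumes "penta_rec a1 a2 b1 b2 c1 c2 C"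
  shows "tri_rec a1 b1 c1 x (\<lambda>m. poly (C (2 * m)) x)"
    and "tri_rec a2 b2 c2 x (\<lambda>m. poly (C (2 * m + 1)) x)"
proof -
  have 0: "[:0, 1:] * C 0 = smult a1 (C 0) + smult b1 (C 2)"
    and 1: "[:0, 1:] * C 1 = smult a2 (C 1) + smult b2 (C 3)"
    and odd: "odd i \<Longrightarrow> 3 \<le> i \<Longrightarrow> [:0, 1:] * C (i - 1) =
           smult c1 (C (i - 3)) + smult a1 (C (i - 1)) + smult b1 (C (i + 1))"
    and even: "even i \<Longrightarrow> 3 \<le> i \<Longrightarrow> [:0, 1:] * C (i - 1) =
           smult c2 (C (i - 3)) + smult a2 (C (i - 1)) + smult b2 (C (i + 1))" for i
    using assms unfolding penta_rec_def by blast+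
  \<comment> \<open>The relation with index \<open>i\<close> is centred at \<open>C (i - 1)\<close>:
    odd \<open>i = 2 * m + 3\<close> governs the even-indexed terms, even
    \<open>i = 2 * m + 4\<close> the odd-indexed ones.\<close>
  have idx: "2 * m + 3 - 1 = 2 * Suc m" "2 * m + 3 - 3 = 2 * m" "2 * m + 3 + 1 = 2 * (m + 2)"
    and idx': "2 * m + 4 - 1 = 2 * Suc m + 1" "2 * m + 4 - 3 = 2 * m + 1" "2 * m + 4 + 1 = 2 * (m + 2) + 1"
    for m :: nat
    by simp_all
  have "x * poly (C (2 * Suc m)) x =
      c1 * poly (C (2 * m)) x + a1 * poly (C (2 * Suc m)) x + b1 * poly (C (2 * (m + 2))) x" for m
    using arg_cong[OF odd[of "2 * m + 3"], of "\<lambda>p. poly p x"]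
    unfolding idx by simp
  moreover have "x * poly (C (2 * Suc m + 1)) x =
      c2 * poly (C (2 * m + 1)) x + a2 * poly (C (2 * Suc m + 1)) x + b2 * poly (C (2 * (m + 2) + 1)) x" for m
    using arg_cong[OF even[of "2 * m + 4"], of "\<lambda>p. poly p x"]
    unfolding idx' by simp
  ultimately show "tri_rec a1 b1 c1 x (\<lambda>m. poly (C (2 * m)) x)"
      "tri_rec a2 b2 c2 x (\<lambda>m. poly (C (2 * m + 1)) x)"
    using arg_cong[OF 0, of "\<lambda>p. poly p x"] arg_cong[OF 1, of "\<lambda>p. poly p x"]
    unfolding tri_rec_def by (simp_all add: numeral_eq_Suc)
qed

text \<open>The solution is compared with itself under the factors 1 and 0. This annihilates one
  parity class of each of \<open>A\<close> and \<open>B\<close>.\<close>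

lemma tri_rec_zero:
  fixes u :: "nat \<Rightarrow> 'a :: idom"
  assumes "tri_rec a b c x u" "b \<noteq> 0" "u 0 = 0"
  shows "u m = 0"
  using tri_rec_unique[OF assms(1,1,2), of 1 0 m] assms(3) by simp

section \<open>The numbering of the eigenvalues\<close>

lemma penta_eig_odd: "penta_eig a1 a2 s1 s2 (2 * t) (2 * j - Suc 0) = tri_eig a1 s1 t j"
  if "j \<ge> 1"
proof -
  \<comment> \<open>For k = 2j - 1 and n = 2t the angle (k+1) pi / (n+2) loses a factor 2.\<close>
  have "odd (2 * j - Suc 0)" "real (2 * j - Suc 0 + 1) * pi / real (2 * t + 2) = real j * pi / real (t + 1)"
    using that by (auto simp: field_simps)
  then show ?thesis by (simp add: penta_eig_def tri_eig_def)
qed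

lemma penta_eig_even: "penta_eig a1 a2 s1 s2 (2 * t) (2 * j) = tri_eig a2 s2 t j"
proof -
  have "real (2 * j) * pi / real (2 * t + 2) = real j * pi / real (t + 1)"
    by (auto simp: field_simps)
  then show ?thesis by (simp add: penta_eig_def tri_eig_def)
qed

lemma prod_odd_even:
  fixes f :: "nat \<Rightarrow> 'a :: comm_monoid_mult"
  shows "(\<Prod>k = 1..2 * t. f k) = (\<Prod>j = 1..t. f (2 * j - 1)) * (\<Prod>j = 1..t. f (2 * j))"
  by (induction t) (simp_all add: ac_simps)

theorem theorem7:
  fixes n t :: nat
    and a1 a2 b1 b2 c1 c2 s1 s2 :: complex
    and A B :: "nat \<Rightarrow> complex poly"
    and K :: "complex mat"
    and \<alpha> :: "nat \<Rightarrow> complex"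
  assumes "t \<ge> 1" and "n = 2 * t"
    and "b1 \<noteq> 0" and "b2 \<noteq> 0" and "c1 \<noteq> 0" and "c2 \<noteq> 0"
    and "s1 ^ 2 = b1 * c1" and "s2 ^ 2 = b2 * c2"
    and "K = penta_mat a1 a2 b1 b2 c1 c2 n"
    and "A 0 = 0" and "A 1 = 1" and "penta_rec a1 a2 b1 b2 c1 c2 A"
    and "B 0 = 1" and "B 1 = 0" and "penta_rec a1 a2 b1 b2 c1 c2 B"
    and "\<alpha> = penta_eig a1 a2 s1 s2 n"
  shows "spectrum K = \<alpha> ` {1..n}
    \<and> char_poly K = (\<Prod>k = 1..n. [:- \<alpha> k, 1:])
    \<and> (\<forall>j\<in>{1..n}. odd j \<longrightarrow> eigenvector K (vec n (\<lambda>i. poly (B i) (\<alpha> j))) (\<alpha> j))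
    \<and> (\<forall>j\<in>{1..n}. even j \<longrightarrow> eigenvector K (vec n (\<lambda>i. poly (A i) (\<alpha> j))) (\<alpha> j))"
proof (intro conjI ballI impI)
  have K: "K \<in> carrier_mat n n"
    using assms by (simp add: penta_mat_def)
  \<comment> \<open>Multiplying the factors of the two blocks keeps multiplicities, also where the
    blocks share an eigenvalue.\<close>
  have "char_poly K = (\<Prod>j = 1..t. [:- tri_eig a1 s1 t j, 1:]) * (\<Prod>j = 1..t. [:- tri_eig a2 s2 t j, 1:])"
    using assms by (simp add: char_poly_penta_mat char_poly_tri_mat)
  also have "\<dots> = (\<Prod>k = 1..n. [:- \<alpha> k, 1:])"
    unfolding assms(2,16) prod_odd_even penta_eig_even
    by (rule arg_cong2[where f = "(*)"]) (auto intro!: prod.cong simp: penta_eig_odd)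
  finally show cp: "char_poly K = (\<Prod>k = 1..n. [:- \<alpha> k, 1:])" .
  show "spectrum K = \<alpha> ` {1..n}"
    by (auto simp: spectrum_root_char_poly[OF K] cp poly_prod)
next
  fix k assume k: "k \<in> {1..n}" "odd k"
  \<comment> \<open>From k = 2m + 1 the witness is j = m + 1.\<close>
  then obtain j where j: "k = 2 * j - 1" "1 \<le> j" "j \<le> t"
    using \<open>n = 2 * t\<close> by (auto elim!: oddE intro: that[of "Suc _"])
  have \<alpha>: "\<alpha> k = tri_eig a1 s1 t j"
    using assms(2,16) j by (simp add: penta_eig_odd)
  note B = tri_rec_poly_penta_rec[OF assms(15)]
  have "K *\<^sub>v vec n (\<lambda>i. poly (B i) (\<alpha> k)) = \<alpha> k \<cdot>\<^sub>v vec n (\<lambda>i. poly (B i) (\<alpha> k))"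
    unfolding \<open>n = 2 * t\<close> \<open>K = _\<close>
  proof (rule penta_mat_mult_vec[OF B])
    \<comment> \<open>The even-indexed terms of \<open>B\<close> vanish at 2t by the choice of
      eigenvalue; the odd-indexed ones vanish identically, since \<open>B 1 = 0\<close>.\<close>
    show "poly (B (2 * t)) (\<alpha> k) = 0"
      using tri_rec_tri_eig_zero[OF assms(3,7) j(2,3) B(1)] \<alpha> by simp
    show "poly (B (2 * t + 1)) (\<alpha> k) = 0"
      using tri_rec_zero[OF B(2) assms(4), of _ t] assms(14) by simp
  qed
  moreover have "vec n (\<lambda>i. poly (B i) (\<alpha> k)) $ 0 \<noteq> 0\<^sub>v n $ 0"
    using assms(1,2,13) by simp
  then have "vec n (\<lambda>i. poly (B i) (\<alpha> k)) \<noteq> 0\<^sub>v n"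
    by (rule contrapos_nn) (rule arg_cong)
  ultimately show "eigenvector K (vec n (\<lambda>i. poly (B i) (\<alpha> k))) (\<alpha> k)"
    using assms(9) by (simp add: eigenvector_def penta_mat_def)
next
  fix k assume k: "k \<in> {1..n}" "even k"
  then obtain j where j: "k = 2 * j" "1 \<le> j" "j \<le> t"
    using \<open>n = 2 * t\<close> by auto
  have \<alpha>: "\<alpha> k = tri_eig a2 s2 t j"
    using assms(2,16) j by (simp add: penta_eig_even)
  note A = tri_rec_poly_penta_rec[OF assms(12)]
  have "K *\<^sub>v vec n (\<lambda>i. poly (A i) (\<alpha> k)) = \<alpha> k \<cdot>\<^sub>v vec n (\<lambda>i. poly (A i) (\<alpha> k))"
    unfolding \<open>n = 2 * t\<close> \<open>K = _\<close>
  proof (rule penta_mat_mult_vec[OF A])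
    show "poly (A (2 * t)) (\<alpha> k) = 0"
      using tri_rec_zero[OF A(1) assms(3), of _ t] assms(10) by simp
    show "poly (A (2 * t + 1)) (\<alpha> k) = 0"
      using tri_rec_tri_eig_zero[OF assms(4,8) j(2,3) A(2)] \<alpha> by simp
  qed
  \<comment> \<open>Entry 0 is zero here, so entry 1, with \<open>A 1 = 1\<close>, witnesses that
    the vector is nonzero; it exists as n is at least 2.\<close>
  moreover have "vec n (\<lambda>i. poly (A i) (\<alpha> k)) $ 1 \<noteq> 0\<^sub>v n $ 1"
    using assms(1,2,11) by simp
  then have "vec n (\<lambda>i. poly (A i) (\<alpha> k)) \<noteq> 0\<^sub>v n"
    by (rule contrapos_nn) (rule arg_cong)
  ultimately show "eigenvector K (vec n (\<lambda>i. poly (A i) (\<alpha> k))) (\<alpha> k)"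
    using assms(9) by (simp add: eigenvector_def penta_mat_def)
qed

end
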